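(* Let $\sigma$ be a balanced skew shape of height $a$ and width $b$, let $P_\sigma$ be the corresponding poset, and let $\varphi\colon\mathcal{J}(P_\sigma)\to\mathcal{J}(P_\sigma)$ be either rowmotion or gyration. Then the antichain cardinality statistic $I\mapsto \#A(I)$ is $\frac{ab}{a+b}$-mesic with respect to the action of $\varphi$ on $\mathcal{J}(P_\sigma)$.
   Context: Skew shapes. For partitions $\nu\subseteq\lambda$ (i.e. $\nu_i\le\lambda_i$ for all $i$), the skew shape $\sigma=\lambda/\nu$ is the diagram obtained by removing the Young diagram of $\nu$ from that of $\lambda$ (English notation). Its height $a$ is its number of rows and its width $b$ its number of columns. Place $\sigma$ in an $a\times b$ rectangle with coordinates (row coordinate increasing downward, column coordinate increasing rightward) so that the northwest corner of the rectangle is $(0,0)$ and the southeast corner is $(a,b)$. Write $[i,j]$ for the unit box whose southeast corner is $(i,j)$. The poset $P_\sigma$ has as elements the boxes of $\sigma$, with $[i,j]\le[k,l]$ iff $i\le k$ and $j\le l$. The shape $\sigma$ is connected if $P_\sigma$ is a connected (in particular nonempty) poset. Outward corners. For connected $\sigma$, an outward corner of $\sigma$ is a pair of consecutive steps along the boundary of $\sigma$ that do not belong to the same line and do not border a common box of $\sigma$; it occurs at the lattice point $(i,j)$ where its two steps meet. Each outward corner is either a northwest corner (part of the northwest border of $\sigma$: $[i,j]\notin\sigma$ while $[i+1,j],[i,j+1]\in\sigma$) or a southeast corner (part of the southeast border: $[i+1,j+1]\notin\sigma$ while $[i+1,j],[i,j+1]\in\sigma$). $C(\sigma)$ denotes the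 set of outward corners. For an outward corner $c$ occurring at $(i,j)$, the displacement is $\delta(c)=1-\frac{i}{a}-\frac{j}{b}$ if $c$ is a northwest corner, and $\delta(c)=-1+\frac{i}{a}+\frac{j}{b}$ if $c$ is a southeast corner. A skew shape $\sigma$ is balanced if it is connected and $\delta(c)=0$ for all $c\in C(\sigma)$. Order ideals and toggles. For a finite poset $P$ with $n$ elements, $\mathcal{J}(P)$ is the set of order ideals (down-closed subsets) of $P$. For $p\in P$, the toggle $\tau_p\colon\mathcal{J}(P)\to\mathcal{J}(P)$ is $\tau_p(I)=I\,\Delta\,\{p\}$ (symmetric difference) if this set is in $\mathcal{J}(P)$, and $\tau_p(I)=I$ otherwise. Toggles $\tau_p,\tau_q$ commute unless one of $p,q$ covers the other. Rowmotion is the composition $\tau_{\ell^{-1}(1)}\circ\tau_{\ell^{-1}(2)}\circ\cdots\circ\tau_{\ell^{-1}(n)}$, where $\ell\colon P\to\{1,\dots,n\}$ is any linear extension (order-preserving bijection); it does not depend on $\ell$. Gyration is defined when $P$ is ranked, i.e. there is a function $\mathrm{rk}\colon P\to\mathbb{Z}_{\ge0}$ with $0$ in its image and $\mathrm{rk}(q)=\mathrm{rk}(p)+1$ whenever $q$ covers $p$ (for $P_\sigma$ with $\sigma$ connected, $\mathrm{rk}([i,j])=i+j-\kappa$ for an appropriate constant $\kappa$). It is $\tau_{o_1}\circ\cdots\circ\tau_{o_{n_1}}\circ\tau_{e_1}\circ\cdots\circ\tau_{e_{n_0}}$, where $\{e_1,\dots,e_{n_0}\}$ are the elements of even rank and $\{o_1,\dots,o_{n_1}\}$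 those of odd rank. Antichain cardinality. For $I\in\mathcal{J}(P)$, $A(I)$ is the antichain of maximal elements of $I$. Homomesy. A statistic $f\colon\mathcal{S}\to\mathbb{R}$ on a finite set $\mathcal{S}$ is $c$-mesic with respect to an invertible map $\varphi\colon\mathcal{S}\to\mathcal{S}$ if $\frac{1}{\#\mathcal{O}}\sum_{s\in\mathcal{O}}f(s)=c$ for every $\varphi$-orbit $\mathcal{O}$. *)

theory Defs
  imports Complex_Main "HOL-Library.Product_Order" "HOL-Combinatorics.Orbits"
begin

section \<open>Order ideals, toggles, rowmotion and gyration\<close>

text \<open>A finite poset is a finite subset of a type of class \<^class>\<open>order\<close>, with the induced order.\<close>

definition order_ideals :: "'a::order set \<Rightarrow> 'a set set" where
  "order_ideals P = {I. I \<subseteq> P \<and> (\<forall>x\<in>I. \<forall>y\<in>P. y \<le> x \<longrightarrow> y \<in> I)}"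

definition toggle :: "'a::order set \<Rightarrow> 'a \<Rightarrow> 'a set \<Rightarrow> 'a set" where
  "toggle P p I = (if sym_diff I {p} \<in> order_ideals P then sym_diff I {p} else I)"

text \<open>\<open>toggles P [p\<^sub>1, \<dots>, p\<^sub>n]\<close> is the composition \<open>toggle P p\<^sub>1 \<circ> \<dots> \<circ> toggle P p\<^sub>n\<close>;
  the last element of the list is toggled first.\<close>

definition toggles :: "'a::order set \<Rightarrow> 'a list \<Rightarrow> 'a set \<Rightarrow> 'a set" where
  "toggles P ps = foldr (toggle P) ps"

definition linear_extension :: "'a::order set \<Rightarrow> ('a \<Rightarrow> nat) \<Rightarrow> bool" where
  "linear_extension P l \<longleftrightarrow>
     bij_betw l P {1..card P} \<and> (\<forall>p\<in>P. \<forall>q\<in>P. p \<le> q \<longrightarrow> l p \<le> l q)"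

text \<open>Rowmotion and gyration are maps on \<^term>\<open>order_ideals P\<close>, so their values outside
  this set are left unconstrained.  They do not depend on the choice of the linear extension,
  respectively of the enumerations of the elements of even and of odd rank; the predicates
  admit every choice.\<close>

definition is_rowmotion :: "'a::order set \<Rightarrow> ('a set \<Rightarrow> 'a set) \<Rightarrow> bool" where
  "is_rowmotion P \<phi> \<longleftrightarrow>
     (\<exists>l. linear_extension P l \<and>
       (\<forall>I\<in>order_ideals P. \<phi> I = toggles P (map (inv_into P l) [1..<card P + 1]) I))"

definition covered_by :: "'a::order set \<Rightarrow> 'a \<Rightarrow> 'a \<Rightarrow> bool" where
  "covered_by P p q \<longleftrightarrow> p \<in> P \<and> q \<in> P \<and> p < q \<and> \<not> (\<exists>r\<in>P. p < r \<and> r < q)"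

definition rank_function :: "'a::order set \<Rightarrow> ('a \<Rightarrow> nat) \<Rightarrow> bool" where
  "rank_function P rk \<longleftrightarrow>
     0 \<in> rk ` P \<and> (\<forall>p q. covered_by P p q \<longrightarrow> rk q = rk p + 1)"

definition is_gyration :: "'a::order set \<Rightarrow> ('a set \<Rightarrow> 'a set) \<Rightarrow> bool" where
  "is_gyration P \<phi> \<longleftrightarrow>
     (\<exists>rk es os. rank_function P rk \<and>
       distinct es \<and> set es = {p\<in>P. even (rk p)} \<and>
       distinct os \<and> set os = {p\<in>P. odd (rk p)} \<and>
       (\<forall>I\<in>order_ideals P. \<phi> I = toggles P (os @ es) I))"

definition maximal_elements :: "'a::order set \<Rightarrow> 'a set" where
  "maximal_elements I = {x\<in>I. \<not> (\<exists>y\<in>I. x < y)}"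

definition connected_poset :: "'a::order set \<Rightarrow> bool" where
  "connected_poset P \<longleftrightarrow> P \<noteq> {} \<and>
     (\<forall>x\<in>P. \<forall>y\<in>P. (x, y) \<in> {(u, v). u \<in> P \<and> v \<in> P \<and> (u \<le> v \<or> v \<le> u)}\<^sup>*)"


section \<open>Homomesy\<close>

text \<open>For a permutation of a finite set, the forward orbit \<^const>\<open>orbit\<close> is the full orbit.\<close>

definition mesic :: "'s set \<Rightarrow> ('s \<Rightarrow> 's) \<Rightarrow> ('s \<Rightarrow> real) \<Rightarrow> real \<Rightarrow> bool" where
  "mesic S \<phi> f c \<longleftrightarrow> finite S \<and> bij_betw \<phi> S S \<and>
     (\<forall>orb \<in> orbit \<phi> ` S. 1 / real (card orb) * (\<Sum>s\<in>orb. f s) = c)"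


section \<open>Skew shapes\<close>

text \<open>A partition is a function giving the parts \<open>p 1 \<ge> p 2 \<ge> \<dots>\<close>; the value \<open>p 0\<close> is
  irrelevant.\<close>

definition is_partition :: "(nat \<Rightarrow> nat) \<Rightarrow> bool" where
  "is_partition p \<longleftrightarrow> (\<forall>i\<ge>1. p (i + 1) \<le> p i) \<and> finite {i. p i \<noteq> 0}"

text \<open>The pair \<open>(i, j)\<close> stands for the unit box whose southeast corner is the lattice point
  \<open>(i, j)\<close>, rows increasing downward.  The componentwise order on pairs is the order of the
  poset of the shape, so that a shape serves as its own poset.\<close>

type_synonym box = "nat \<times> nat"

definition skew_diagram :: "(nat \<Rightarrow> nat) \<Rightarrow> (nat \<Rightarrow> nat) \<Rightarrow> box set" where
  "skew_diagram lam nu = {(i, j). 1 \<le> i \<and> nu i < j \<and> j \<le> lam i}"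

text \<open>The diagram may have empty rows at its top and empty columns at its left; it is translated
  so that its first nonempty row and column get coordinate 1, which places the northwest
  corner of its bounding rectangle at \<open>(0, 0)\<close>.\<close>

definition skew_shape :: "(nat \<Rightarrow> nat) \<Rightarrow> (nat \<Rightarrow> nat) \<Rightarrow> box set" where
  "skew_shape lam nu =
     (let D = skew_diagram lam nu
      in (\<lambda>(i, j). (i + 1 - Min (fst ` D), j + 1 - Min (snd ` D))) ` D)"

definition shape_height :: "box set \<Rightarrow> nat" where
  "shape_height \<sigma> = card (fst ` \<sigma>)"

definition shape_width :: "box set \<Rightarrow> nat" where
  "shape_width \<sigma> = card (snd ` \<sigma>)"

text \<open>An outward corner, given by its kind and the lattice point at which it occurs.\<close>

datatype corner = Northwest nat nat | Southeast nat nat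

definition outward_corners :: "box set \<Rightarrow> corner set" where
  "outward_corners \<sigma> =
     {Northwest i j |i j. (i, j) \<notin> \<sigma> \<and> (i + 1, j) \<in> \<sigma> \<and> (i, j + 1) \<in> \<sigma>} \<union>
     {Southeast i j |i j. (i + 1, j + 1) \<notin> \<sigma> \<and> (i + 1, j) \<in> \<sigma> \<and> (i, j + 1) \<in> \<sigma>}"

fun displacement :: "box set \<Rightarrow> corner \<Rightarrow> real" where
  "displacement \<sigma> (Northwest i j) =
     1 - real i / real (shape_height \<sigma>) - real j / real (shape_width \<sigma>)"
| "displacement \<sigma> (Southeast i j) =
     - 1 + real i / real (shape_height \<sigma>) + real j / real (shape_width \<sigma>)"

definition balanced :: "box set \<Rightarrow> bool" where
  "balanced \<sigma> \<longleftrightarrow> connected_poset \<sigma> \<and> (\<forall>c\<in>outward_corners \<sigma>. displacement \<sigma> c = 0)"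

end

theory Submission
  imports Defs
begin

text \<open>
  For an order ideal \<open>I\<close> and an element \<open>p\<close> of the poset, let \<open>T\<^sub>p(I)\<close> be \<open>1\<close> if the toggle at
  \<open>p\<close> adds \<open>p\<close> to \<open>I\<close>, \<open>-1\<close> if it removes \<open>p\<close>, and \<open>0\<close> if it does nothing
  (\<open>toggleability\<close> below). The proof combines two facts.

  The first is dynamical: for rowmotion and for gyration, \<open>T\<^sub>p\<close> sums to zero over every orbit.
  Rowmotion turns the minimal elements of the complement of \<open>I\<close> into the maximal elements of its
  image, so along an orbit \<open>p\<close> is addable as often as it is maximal. Under gyration \<open>p\<close> is
  toggled once, among elements that do not influence it; hence \<open>T\<^sub>p\<close> measures, up to sign, the
  change of the indicator of \<open>p \<in> I\<close> in one step, and such changes cancel along an orbit.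
  Consequently every statistic of the form \<open>c + (\<Sum>p. w p * T\<^sub>p)\<close> is \<open>c\<close>-mesic
  (lemma \<open>mesic_if_toggle_combination\<close>).

  The second is geometric: on a balanced skew shape the number of maximal elements has this form
  with \<open>c = ab/(a+b)\<close>. An ideal \<open>I\<close> is bounded by a lattice path from \<open>(a, 0)\<close> to \<open>(0, b)\<close>.
  Its maximal boxes are those northwest of its east-north turns, and the boxes that can be added
  are those southeast of its north-east turns; the other turns are at outward corners of
  the shape. Consider the function
  \<open>t(i, j) = i/a + j/b - 1\<close>. The sum of \<open>t\<close> over the east-north turns minus its sum over the
  north-east turns is always \<open>1\<close>. This is a telescoping sum over the horizontal runs of the path:
  the two ends of a run lie on the same line, so the difference of \<open>t\<close> is the length of the run
  divided by \<open>b\<close>, and \<open>t\<close> vanishes at the two ends of the path, where a turn may be missing.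
  Balancedness says that \<open>t\<close> vanishes at the outward corners, so only toggleable boxes
  contribute. The box \<open>p = [i, j]\<close> contributes \<open>t(i, j)\<close> if it is maximal and
  \<open>-t(i-1, j-1) = -t(i, j) + (1/a + 1/b)\<close> if it is addable, so
  \<open>1 = (1/a + 1/b) * (number of addable boxes) - (\<Sum>p. t(p) * T\<^sub>p(I))\<close>.
  Since the number of addable boxes exceeds the number of maximal ones by
  \<open>\<Sum>p. T\<^sub>p(I)\<close>, the claim follows after multiplication by \<open>ab/(a+b)\<close>
  (lemmas \<open>tilt_turns\<close> and \<open>card_maximal_eq\<close>).
\<close>

section \<open>Toggles on order ideals\<close>

definition addable :: "'a::order set \<Rightarrow> 'a set \<Rightarrow> 'a set" where
  "addable P I = {p \<in> P - I. \<forall>x\<in>P. x < p \<longrightarrow> x \<in> I}"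

definition toggleability :: "'a::order set \<Rightarrow> 'a set \<Rightarrow> 'a \<Rightarrow> real" where
  "toggleability P I p = of_bool (p \<in> addable P I) - of_bool (p \<in> maximal_elements I)"

lemma order_idealsD:
  assumes "I \<in> order_ideals P" "x \<in> I" "y \<in> P" "y \<le> x"
  shows "y \<in> I"
  using assms by (auto simp: order_ideals_def)

lemma order_ideals_subset: "I \<in> order_ideals P \<Longrightarrow> I \<subseteq> P"
  by (auto simp: order_ideals_def)

lemma toggle_addable:
  assumes "I \<in> order_ideals P" "p \<in> addable P I"
  shows "toggle P p I = insert p I" "insert p I \<in> order_ideals P"
proof -
  show *: "insert p I \<in> order_ideals P"
    using assms unfolding order_ideals_def addable_def by (auto simp: order.order_iff_strict)
  have "sym_diff I {p} = insert p I"
    using assms by (auto simp: addable_def)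
  with * show "toggle P p I = insert p I" by (simp add: toggle_def)
qed

lemma toggle_maximal:
  assumes "I \<in> order_ideals P" "p \<in> maximal_elements I"
  shows "toggle P p I = I - {p}" "I - {p} \<in> order_ideals P"
proof -
  show *: "I - {p} \<in> order_ideals P"
    using assms unfolding order_ideals_def maximal_elements_def
    by (auto simp: order.order_iff_strict)
  have "sym_diff I {p} = I - {p}"
    using assms by (auto simp: maximal_elements_def)
  with * show "toggle P p I = I - {p}" by (simp add: toggle_def)
qed

lemma toggle_neither:
  assumes "I \<in> order_ideals P" "p \<notin> addable P I" "p \<notin> maximal_elements I"
  shows "toggle P p I = I"
proof -
  have "sym_diff I {p} \<notin> order_ideals P"
  proof (cases "p \<in> I")
    case True
    then obtain y where "y \<in> I" "p < y"
      using assms by (auto simp: maximal_elements_def)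
    then have "y \<in> sym_diff I {p}" "p \<in> P" "p \<le> y" "p \<notin> sym_diff I {p}"
      using True order_ideals_subset[OF assms(1)] by auto
    then show ?thesis using order_idealsD by blast
  next
    case False
    show ?thesis
    proof
      assume J: "sym_diff I {p} \<in> order_ideals P"
      have p: "p \<in> sym_diff I {p}" using False by auto
      then have "p \<in> P" using order_ideals_subset[OF J] by blast
      then obtain x where x: "x \<in> P" "x < p" "x \<notin> I"
        using assms False by (auto simp: addable_def)
      then have "x \<in> sym_diff I {p}" using order_idealsD[OF J p] by (auto dest: less_imp_le)
      then show False using x by auto
    qed
  qed
  then show ?thesis by (simp add: toggle_def)
qed

lemma toggle_in_order_ideals:
  "I \<in> order_ideals P \<Longrightarrow> toggle P p I \<in> order_ideals P"
  by (simp add: toggle_def)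

lemma toggle_involution:
  assumes "I \<in> order_ideals P"
  shows "toggle P p (toggle P p I) = I"
proof -
  have "sym_diff (sym_diff I {p}) {p} = I" by auto
  then show ?thesis using assms by (simp add: toggle_def)
qed

lemma mem_toggle_other: "x \<noteq> p \<Longrightarrow> x \<in> toggle P p I \<longleftrightarrow> x \<in> I"
  by (auto simp: toggle_def)

lemma mem_toggle_self:
  assumes "I \<in> order_ideals P"
  shows "p \<in> toggle P p I \<longleftrightarrow> p \<in> addable P I \<or> p \<in> I \<and> p \<notin> maximal_elements I"
proof -
  consider "p \<in> addable P I" | "p \<in> maximal_elements I"
    | "p \<notin> addable P I" "p \<notin> maximal_elements I" by blast
  then show ?thesis
    using toggle_addable[OF assms] toggle_maximal[OF assms] toggle_neither[OF assms]
    by cases (auto simp: addable_def maximal_elements_def)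
qed

lemma toggles_Nil [simp]: "toggles P [] I = I"
  and toggles_Cons [simp]: "toggles P (p # ps) I = toggle P p (toggles P ps I)"
  and toggles_append [simp]: "toggles P (ps @ qs) I = toggles P ps (toggles P qs I)"
  by (simp_all add: toggles_def)

lemma toggles_in_order_ideals:
  "I \<in> order_ideals P \<Longrightarrow> toggles P ps I \<in> order_ideals P"
  by (induction ps) (auto intro: toggle_in_order_ideals)

lemma mem_toggles_other: "x \<notin> set ps \<Longrightarrow> x \<in> toggles P ps I \<longleftrightarrow> x \<in> I"
  by (induction ps) (auto simp: mem_toggle_other)

lemma bij_betw_toggle: "bij_betw (toggle P p) (order_ideals P) (order_ideals P)"
  by (rule bij_betw_byWitness[where f' = "toggle P p"])
    (auto simp: toggle_involution toggle_in_order_ideals)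

lemma bij_betw_toggles: "bij_betw (toggles P ps) (order_ideals P) (order_ideals P)"
proof (induction ps)
  case Nil
  then show ?case by (simp add: toggles_def bij_betw_def)
next
  case (Cons p ps)
  have "toggles P (p # ps) = toggle P p \<circ> toggles P ps" by (auto simp: toggles_def)
  then show ?case using bij_betw_trans[OF Cons bij_betw_toggle] by metis
qed

section \<open>Rowmotion\<close>

text \<open>The elements above \<open>p\<close> are toggled before \<open>p\<close> and those below after it. When its turn
  comes, \<open>p\<close> therefore sees the final state of the elements above it and the initial state of
  the elements below it. If \<open>p\<close> is addable at the start, it cannot lie below an element present
  when it is toggled, so it is added and nothing above it is present at the end. Conversely, if it
  ends up maximal, then nothing above it is present when it is toggled, so it would have been
  removed had it been present; hence the toggle added it.\<close>

lemma maximal_toggles_linear_extension: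
  assumes I: "I \<in> order_ideals P" and ps: "set ps = P" "distinct ps"
    and sorted: "sorted_wrt (\<lambda>x y. \<not> y < x) ps"
  shows "maximal_elements (toggles P ps I) = addable P I"
proof (rule set_eqI)
  fix p
  let ?F = "toggles P ps I"
  have F: "?F \<in> order_ideals P" using I by (rule toggles_in_order_ideals)
  show "p \<in> maximal_elements ?F \<longleftrightarrow> p \<in> addable P I"
  proof (cases "p \<in> P")
    case False
    then show ?thesis
      using order_ideals_subset[OF F] by (auto simp: addable_def maximal_elements_def)
  next
    case True
    then obtain xs ys where split: "ps = xs @ p # ys"
      using ps(1) by (metis split_list)
    \<comment> \<open>\<open>J\<close> and \<open>K\<close> are the ideals just before and just after \<open>p\<close> is toggled.\<close>
    define J where "J = toggles P ys I"
    define K where "K = toggle P p J"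
    have J: "J \<in> order_ideals P" and K: "K \<in> order_ideals P"
      using I by (auto simp: J_def K_def toggles_in_order_ideals toggle_in_order_ideals)
    have F_eq: "?F = toggles P xs K" by (simp add: split J_def K_def)
    have p_I: "p \<in> J \<longleftrightarrow> p \<in> I" and p_F: "p \<in> ?F \<longleftrightarrow> p \<in> K"
      using ps(2) unfolding F_eq by (auto simp: split J_def mem_toggles_other)
    have above: "y \<in> ?F \<longleftrightarrow> y \<in> J" if "y \<in> P" "p < y" for y
    proof -
      have "y \<notin> set xs" using sorted that by (auto simp: split sorted_wrt_append)
      then show ?thesis using that by (auto simp: F_eq mem_toggles_other K_def mem_toggle_other)
    qed
    have below: "x \<in> J \<longleftrightarrow> x \<in> I" if "x < p" for x
    proof -
      have "x \<notin> set ys" using sorted that by (auto simp: split sorted_wrt_append)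
      then show ?thesis by (auto simp: J_def mem_toggles_other)
    qed
    show ?thesis
    proof
      assume p: "p \<in> addable P I"
      then have "p \<in> addable P J" using p_I below by (auto simp: addable_def)
      then have "p \<in> ?F" using toggle_addable(1)[OF J] p_F by (auto simp: K_def)
      moreover have "\<not> p < y" if "y \<in> ?F" for y
      proof
        assume "p < y"
        moreover have "y \<in> P" using that order_ideals_subset[OF F] by blast
        ultimately have "p \<in> J"
          using above that order_idealsD[OF J, of y p] True by auto
        then show False using p p_I by (auto simp: addable_def)
      qed
      ultimately show "p \<in> maximal_elements ?F" by (auto simp: maximal_elements_def)
    next
      assume p: "p \<in> maximal_elements ?F"
      then have pK: "p \<in> K" using p_F by (auto simp: maximal_elements_def)
      have "p \<notin> J"
      proof
        assume "p \<in> J"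
        moreover have "\<not> p < y" if "y \<in> J" for y
          using p above[of y] that order_ideals_subset[OF J] by (auto simp: maximal_elements_def)
        ultimately have "p \<in> maximal_elements J" by (auto simp: maximal_elements_def)
        then show False using toggle_maximal(1)[OF J] pK by (auto simp: K_def)
      qed
      then have "p \<in> addable P J" using mem_toggle_self[OF J] pK by (auto simp: K_def)
      then show "p \<in> addable P I" using p_I below by (auto simp: addable_def)
    qed
  qed
qed

lemma maximal_rowmotion:
  assumes "is_rowmotion P \<phi>" "finite P" "I \<in> order_ideals P"
  shows "maximal_elements (\<phi> I) = addable P I"
proof -
  obtain l where l: "linear_extension P l"
    and \<phi>: "\<And>I. I \<in> order_ideals P \<Longrightarrow>
      \<phi> I = toggles P (map (inv_into P l) [1..<card P + 1]) I"
    using assms(1) unfolding is_rowmotion_def by blast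
  let ?ps = "map (inv_into P l) [1..<card P + 1]"
  have bij: "bij_betw l P {1..card P}"
    and mono: "\<And>p q. p \<in> P \<Longrightarrow> q \<in> P \<Longrightarrow> p \<le> q \<Longrightarrow> l p \<le> l q"
    using l by (auto simp: linear_extension_def)
  have inv: "bij_betw (inv_into P l) {1..card P} P"
    using bij by (rule bij_betw_inv_into)
  have set_eq: "set [1..<card P + 1] = {1..card P}" by auto
  have "set ?ps = P"
    using inv unfolding set_map set_eq by (rule bij_betw_imp_surj_on)
  moreover have "distinct ?ps"
    using inv unfolding distinct_map set_eq by (auto simp: bij_betw_def)
  moreover have "sorted_wrt (\<lambda>x y. \<not> y < x) ?ps"
    unfolding sorted_wrt_map
  proof (rule sorted_wrt_mono_rel[of _ "(<)"])
    show "sorted_wrt (<) [1..<card P + 1]" by (simp del: upt_Suc)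
    fix i j assume ij: "i \<in> set [1..<card P + 1]" "j \<in> set [1..<card P + 1]" "i < j"
    show "\<not> inv_into P l j < inv_into P l i"
    proof
      assume less: "inv_into P l j < inv_into P l i"
      have "inv_into P l i \<in> P" "inv_into P l j \<in> P"
        using ij inv unfolding set_eq by (auto dest: bij_betwE)
      then have "l (inv_into P l j) \<le> l (inv_into P l i)"
        using mono less by auto
      then show False
        using ij bij unfolding set_eq by (simp add: bij_betw_inv_into_right)
    qed
  qed
  ultimately show ?thesis
    using maximal_toggles_linear_extension[OF assms(3), of ?ps] \<phi>[OF assms(3)] by simp
qed

section \<open>Gyration\<close>

text \<open>If toggling \<open>q\<close> changed the status of \<open>p\<close>, the two would be comparable, hence by the
  hypothesis separated by some \<open>r\<close>; but the presence or absence of \<open>r\<close> that the status of one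
  of them forces blocks the toggle at the other. Each claim is first proved in one direction; the
  other follows because the toggle is an involution.\<close>

lemma toggle_preserves_status:
  assumes I: "I \<in> order_ideals P" and "p \<noteq> q"
    and ncov: "\<not> covered_by P p q" "\<not> covered_by P q p"
  shows "p \<in> addable P (toggle P q I) \<longleftrightarrow> p \<in> addable P I" (is ?A)
    and "p \<in> maximal_elements (toggle P q I) \<longleftrightarrow> p \<in> maximal_elements I" (is ?M)
proof -
  have A: "p \<in> addable P (toggle P q I)" if I: "I \<in> order_ideals P" and p: "p \<in> addable P I" for I
  proof -
    have "x \<in> toggle P q I" if x: "x \<in> P" "x < p" for x
    proof (rule ccontr)
      assume not: "x \<notin> toggle P q I"
      have "x \<in> I" using p x by (auto simp: addable_def)
      then have "x = q" "q \<in> I" using not mem_toggle_other[of x q P I] by auto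
      then obtain r where r: "r \<in> P" "q < r" "r < p"
        using ncov(2) x p by (auto simp: covered_by_def addable_def)
      then have "r \<in> I" using p by (auto simp: addable_def)
      then have "q \<notin> maximal_elements I" using r by (auto simp: maximal_elements_def)
      then show False using not \<open>x = q\<close> \<open>q \<in> I\<close> mem_toggle_self[OF I] by blast
    qed
    then show ?thesis using p mem_toggle_other[OF \<open>p \<noteq> q\<close>, of P I] by (auto simp: addable_def)
  qed
  have M: "p \<in> maximal_elements (toggle P q I)"
    if I: "I \<in> order_ideals P" and p: "p \<in> maximal_elements I" for I
  proof -
    have "\<not> p < y" if y: "y \<in> toggle P q I" for y
    proof
      assume less: "p < y"
      then have "y \<notin> I" using p by (auto simp: maximal_elements_def)
      then have "y = q" using y mem_toggle_other[of y q P I] by auto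
      then have q: "q \<in> addable P I" using y \<open>y \<notin> I\<close> mem_toggle_self[OF I] by blast
      moreover have "p \<in> P" using p order_ideals_subset[OF I] by (auto simp: maximal_elements_def)
      ultimately obtain r where r: "r \<in> P" "p < r" "r < q"
        using ncov(1) less \<open>y = q\<close> by (auto simp: covered_by_def addable_def)
      then have "r \<in> I" using q by (auto simp: addable_def)
      then show False using p r by (auto simp: maximal_elements_def)
    qed
    then show ?thesis using p mem_toggle_other[OF \<open>p \<noteq> q\<close>, of P I] by (auto simp: maximal_elements_def)
  qed
  show ?A using A[OF I] A[OF toggle_in_order_ideals[OF I]] toggle_involution[OF I] by metis
  show ?M using M[OF I] M[OF toggle_in_order_ideals[OF I]] toggle_involution[OF I] by metis
qed

lemma toggles_preserve_status:
  assumes "I \<in> order_ideals P" "p \<notin> set ps"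
    and "\<And>q. q \<in> set ps \<Longrightarrow> \<not> covered_by P p q \<and> \<not> covered_by P q p"
  shows "(p \<in> addable P (toggles P ps I) \<longleftrightarrow> p \<in> addable P I) \<and>
    (p \<in> maximal_elements (toggles P ps I) \<longleftrightarrow> p \<in> maximal_elements I)"
  using assms(2,3)
proof (induction ps)
  case (Cons q ps)
  then show ?case
    using toggle_preserves_status[OF toggles_in_order_ideals[OF assms(1)], of p q] by simp
qed simp

lemma toggle_status_swap:
  assumes I: "I \<in> order_ideals P"
  shows "p \<in> addable P (toggle P p I) \<longleftrightarrow> p \<in> maximal_elements I"
    and "p \<in> maximal_elements (toggle P p I) \<longleftrightarrow> p \<in> addable P I"
proof -
  have A: "p \<in> maximal_elements (toggle P p I)" if "I \<in> order_ideals P" "p \<in> addable P I" for I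
  proof -
    have "\<not> p < y" if "y \<in> I" for y
      using \<open>p \<in> addable P I\<close> order_idealsD[OF \<open>I \<in> order_ideals P\<close> that, of p]
      by (auto simp: addable_def dest: less_imp_le)
    then show ?thesis using toggle_addable(1)[OF that] by (auto simp: maximal_elements_def)
  qed
  have M: "p \<in> addable P (toggle P p I)"
    if "I \<in> order_ideals P" "p \<in> maximal_elements I" for I
  proof -
    have "p \<in> I" using that by (auto simp: maximal_elements_def)
    then have "x \<in> I" if "x \<in> P" "x < p" for x
      using order_idealsD[OF \<open>I \<in> order_ideals P\<close> \<open>p \<in> I\<close>] that by auto
    then show ?thesis
      using toggle_maximal(1)[OF that] order_ideals_subset[OF that(1)] \<open>p \<in> I\<close>
      by (auto simp: addable_def)
  qed
  show "p \<in> addable P (toggle P p I) \<longleftrightarrow> p \<in> maximal_elements I"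
    using A[OF toggle_in_order_ideals[OF I]] M[OF I] toggle_involution[OF I] by metis
  show "p \<in> maximal_elements (toggle P p I) \<longleftrightarrow> p \<in> addable P I"
    using M[OF toggle_in_order_ideals[OF I]] A[OF I] toggle_involution[OF I] by metis
qed

text \<open>Toggles at elements not related by covering do not influence each other, so each acts as if
  it were the only one, as happens for the elements of one rank parity: it flips the sign of its own toggleability, and the toggleability records
  whether the element has entered or left the ideal.\<close>

lemma toggleability_toggles_noncovering:
  assumes I: "I \<in> order_ideals P" and ps: "distinct ps" "p \<in> set ps"
    and ncov: "\<And>p q. p \<in> set ps \<Longrightarrow> q \<in> set ps \<Longrightarrow> \<not> covered_by P p q"
  shows "toggleability P (toggles P ps I) p = - toggleability P I p"
    and "of_bool (p \<in> toggles P ps I) - of_bool (p \<in> I) = toggleability P I p"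
proof -
  obtain xs ys where split: "ps = xs @ p # ys" using ps(2) by (metis split_list)
  define J where "J = toggles P ys I"
  have J: "J \<in> order_ideals P" using I by (simp add: J_def toggles_in_order_ideals)
  have eq: "toggles P ps I = toggles P xs (toggle P p J)" by (simp add: split J_def)
  have nc: "\<not> covered_by P p q \<and> \<not> covered_by P q p" if "q \<in> set ps" for q
    using ncov that ps(2) by blast
  have IJ: "toggleability P J p = toggleability P I p"
    using toggles_preserve_status[OF I, of p ys] nc ps(1)
    by (auto simp: J_def split toggleability_def)
  have "toggleability P (toggles P ps I) p = toggleability P (toggle P p J) p"
    using toggles_preserve_status[OF toggle_in_order_ideals[OF J], of p xs p] nc ps(1)
    by (auto simp: split eq toggleability_def J_def)
  also have "\<dots> = - toggleability P J p"
    using toggle_status_swap[OF J] by (auto simp: toggleability_def)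
  finally show "toggleability P (toggles P ps I) p = - toggleability P I p" using IJ by simp
  have "p \<in> toggles P ps I \<longleftrightarrow> p \<in> toggle P p J" "p \<in> J \<longleftrightarrow> p \<in> I"
    using ps(1) by (auto simp: split J_def mem_toggles_other)
  then have "of_bool (p \<in> toggles P ps I) - of_bool (p \<in> I) = toggleability P J p"
    using mem_toggle_self[OF J, of p]
    by (auto simp: toggleability_def addable_def maximal_elements_def)
  then show "of_bool (p \<in> toggles P ps I) - of_bool (p \<in> I) = toggleability P I p"
    using IJ by simp
qed

section \<open>Toggle symmetry of orbits\<close>

lemma rowmotion_toggle_symmetric:
  assumes row: "is_rowmotion P \<phi>" and "finite P"
    and orb: "orb \<subseteq> order_ideals P" "bij_betw \<phi> orb orb"
  shows "(\<Sum>I\<in>orb. toggleability P I p) = 0"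
proof -
  let ?m = "\<lambda>I. of_bool (p \<in> maximal_elements I) :: real"
  have "(\<Sum>I\<in>orb. of_bool (p \<in> addable P I)) = (\<Sum>I\<in>orb. ?m (\<phi> I))"
    using maximal_rowmotion[OF row \<open>finite P\<close>] orb(1) by (intro sum.cong) auto
  also have "\<dots> = (\<Sum>I\<in>orb. ?m I)"
    using orb(2) by (rule sum.reindex_bij_betw)
  finally show ?thesis by (simp add: toggleability_def sum_subtractf)
qed

text \<open>The indicator of \<open>p \<in> I\<close> changes by \<open>T\<^sub>p(I)\<close> in one step of gyration if \<open>p\<close> has even
  rank. If \<open>p\<close> has odd rank, it is toggled in the second half of the step, and the change equals
  \<open>-T\<^sub>p\<close> of the image of \<open>I\<close>. In both cases the sum over an orbit telescopes.\<close>

lemma gyration_toggle_symmetric: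
  assumes gyr: "is_gyration P \<phi>" and "p \<in> P"
    and orb: "orb \<subseteq> order_ideals P" "bij_betw \<phi> orb orb"
  shows "(\<Sum>I\<in>orb. toggleability P I p) = 0"
proof -
  obtain rk es os where rk: "rank_function P rk"
    and es: "distinct es" "set es = {p\<in>P. even (rk p)}"
    and os: "distinct os" "set os = {p\<in>P. odd (rk p)}"
    and \<phi>: "\<And>I. I \<in> order_ideals P \<Longrightarrow> \<phi> I = toggles P os (toggles P es I)"
    using gyr unfolding is_gyration_def by auto
  have nce: "\<not> covered_by P x y" if "x \<in> set es" "y \<in> set es" for x y
    using rk that es(2) by (auto simp: rank_function_def)
  have nco: "\<not> covered_by P x y" if "x \<in> set os" "y \<in> set os" for x y
    using rk that os(2) by (auto simp: rank_function_def)
  let ?i = "\<lambda>I. of_bool (p \<in> I) :: real"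
  have inv: "(\<Sum>I\<in>orb. f (\<phi> I)) = (\<Sum>I\<in>orb. f I)" for f :: "'a set \<Rightarrow> real"
    using orb(2) by (rule sum.reindex_bij_betw)
  have zero: "(\<Sum>I\<in>orb. ?i (\<phi> I) - ?i I) = 0"
    using inv[of ?i] by (simp add: sum_subtractf)
  show ?thesis
  proof (cases "even (rk p)")
    case True
    have "?i (\<phi> I) - ?i I = toggleability P I p" if "I \<in> orb" for I
    proof -
      have I: "I \<in> order_ideals P" using that orb by blast
      have "p \<in> \<phi> I \<longleftrightarrow> p \<in> toggles P es I"
        using True by (simp add: \<phi>[OF I] mem_toggles_other os(2))
      then show ?thesis
        using toggleability_toggles_noncovering(2)[OF I es(1) _ nce, of p] True \<open>p \<in> P\<close> es(2) by simp
    qed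
    then show ?thesis using zero by simp
  next
    case False
    have "?i (\<phi> I) - ?i I = - toggleability P (\<phi> I) p" if "I \<in> orb" for I
    proof -
      have I: "I \<in> order_ideals P" using that orb by blast
      let ?J = "toggles P es I"
      have J: "?J \<in> order_ideals P" using I by (rule toggles_in_order_ideals)
      have "p \<in> ?J \<longleftrightarrow> p \<in> I"
        using False by (simp add: mem_toggles_other es(2))
      then show ?thesis
        using toggleability_toggles_noncovering[OF J os(1) _ nco, of p] False \<open>p \<in> P\<close> os(2)
        by (simp add: \<phi>[OF I])
    qed
    then have "(\<Sum>I\<in>orb. toggleability P (\<phi> I) p) = 0"
      using zero by (simp add: sum_negf)
    then show ?thesis using inv[of "\<lambda>I. toggleability P I p"] by simp
  qed
qed

lemma bij_betw_orbit:
  assumes "finite S" "bij_betw \<phi> S S" "s \<in> S"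
  shows "orbit \<phi> s \<subseteq> S" "bij_betw \<phi> (orbit \<phi> s) (orbit \<phi> s)"
proof -
  show sub: "orbit \<phi> s \<subseteq> S"
  proof
    fix x assume "x \<in> orbit \<phi> s"
    then show "x \<in> S" using assms(2,3) by induction (auto dest: bij_betwE)
  qed
  have "inj_on \<phi> (orbit \<phi> s)"
    using assms(2) sub by (auto simp: bij_betw_def intro: inj_on_subset)
  moreover have "\<phi> ` orbit \<phi> s \<subseteq> orbit \<phi> s" by (auto intro: orbit.step)
  moreover have "finite (orbit \<phi> s)" using sub assms(1) by (rule finite_subset)
  ultimately show "bij_betw \<phi> (orbit \<phi> s) (orbit \<phi> s)"
    by (simp add: bij_betw_def endo_inj_surj)
qed

lemma bij_betw_rowmotion_gyration:
  assumes "is_rowmotion P \<phi> \<or> is_gyration P \<phi>"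
  shows "bij_betw \<phi> (order_ideals P) (order_ideals P)"
proof -
  obtain ps where "\<And>I. I \<in> order_ideals P \<Longrightarrow> \<phi> I = toggles P ps I"
    using assms unfolding is_rowmotion_def is_gyration_def by metis
  then show ?thesis using bij_betw_cong bij_betw_toggles by metis
qed

lemma mesic_if_toggle_combination:
  fixes w :: "'a::order \<Rightarrow> real"
  assumes "finite P" and \<phi>: "is_rowmotion P \<phi> \<or> is_gyration P \<phi>"
    and combination: "\<And>I. I \<in> order_ideals P \<Longrightarrow>
      real (card (maximal_elements I)) = c + (\<Sum>p\<in>P. w p * toggleability P I p)"
  shows "mesic (order_ideals P) \<phi> (\<lambda>I. real (card (maximal_elements I))) c"
proof -
  have fin: "finite (order_ideals P)"
    using \<open>finite P\<close> finite_subset[of "order_ideals P" "Pow P"] by (auto simp: order_ideals_def)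
  have bij: "bij_betw \<phi> (order_ideals P) (order_ideals P)"
    using \<phi> by (rule bij_betw_rowmotion_gyration)
  have "1 / real (card orb) * (\<Sum>I\<in>orb. real (card (maximal_elements I))) = c"
    if "orb \<in> orbit \<phi> ` order_ideals P" for orb
  proof -
    obtain I0 where I0: "I0 \<in> order_ideals P" "orb = orbit \<phi> I0" using \<open>orb \<in> _\<close> by auto
    have orb: "orb \<subseteq> order_ideals P" "bij_betw \<phi> orb orb"
      using bij_betw_orbit[OF fin bij I0(1)] by (auto simp: I0(2))
    have "finite orb" using orb(1) fin by (rule finite_subset)
    moreover have "orb \<noteq> {}" using orbit.base[of \<phi> I0] by (auto simp: I0(2))
    ultimately have card: "real (card orb) > 0" by (simp add: card_gt_0_iff)
    have sym: "(\<Sum>I\<in>orb. toggleability P I p) = 0" if "p \<in> P" for p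
      using \<phi> rowmotion_toggle_symmetric[OF _ \<open>finite P\<close> orb]
        gyration_toggle_symmetric[OF _ that orb] by blast
    have "(\<Sum>I\<in>orb. real (card (maximal_elements I)))
        = (\<Sum>I\<in>orb. c + (\<Sum>p\<in>P. w p * toggleability P I p))"
      using combination orb(1) by (intro sum.cong) auto
    also have "\<dots> = real (card orb) * c + (\<Sum>p\<in>P. w p * (\<Sum>I\<in>orb. toggleability P I p))"
      by (simp add: sum.distrib sum_distrib_left sum.swap[of _ orb])
    also have "\<dots> = real (card orb) * c" using sym by simp
    finally show ?thesis using card by simp
  qed
  then show ?thesis using fin bij by (auto simp: mesic_def)
qed

section \<open>Row profiles of connected skew shapes\<close>

text \<open>The normal form of a connected skew shape: row \<open>i\<close> occupies the columns \<open>lo i + 1, \<dots>, hi i\<close>,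
  and connectedness amounts to consecutive rows sharing a column. The last two assumptions say
  that the shape touches the southwest and northeast corners of its bounding rectangle, where the
  boundary paths of all ideals start and end.\<close>

locale skew_profile =
  fixes \<sigma> :: "box set" and lo hi :: "nat \<Rightarrow> nat" and a b :: nat
  assumes mem_shape: "(i, j) \<in> \<sigma> \<longleftrightarrow> i \<in> {1..a} \<and> lo i < j \<and> j \<le> hi i"
    and height_pos: "1 \<le> a"
    and lo_antimono: "1 \<le> i \<Longrightarrow> i < a \<Longrightarrow> lo (Suc i) \<le> lo i"
    and hi_antimono: "1 \<le> i \<Longrightarrow> i < a \<Longrightarrow> hi (Suc i) \<le> hi i"
    and row_nonempty: "1 \<le> i \<Longrightarrow> i \<le> a \<Longrightarrow> lo i < hi i"
    and rows_overlap: "1 \<le> i \<Longrightarrow> i < a \<Longrightarrow> lo i < hi (Suc i)"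
    and lo_last: "lo a = 0"
    and hi_first: "hi 1 = b"
begin

lemma finite_shape: "finite \<sigma>"
proof (rule finite_subset)
  show "\<sigma> \<subseteq> (SIGMA i:{1..a}. {..hi i})" using mem_shape by auto
qed auto

lemma width_pos: "0 < b"
  using row_nonempty[of 1] height_pos hi_first by auto

end

text \<open>An order ideal given by the last column \<open>\<mu> i\<close> of its part of row \<open>i\<close>, with \<open>\<mu> i = lo i\<close>
  for an empty part. The values in rows \<open>0\<close> and \<open>a + 1\<close> are those of the endpoints
  \<open>(0, b)\<close> and \<open>(a, 0)\<close> of the boundary path, which on the horizontal line \<open>i\<close> runs from column
  \<open>\<mu> (i + 1)\<close> to column \<open>\<mu> i\<close>.\<close>

locale skew_ideal = skew_profile +
  fixes I :: "box set" and \<mu> :: "nat \<Rightarrow> nat"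
  assumes mem_ideal: "(i, j) \<in> I \<longleftrightarrow> i \<in> {1..a} \<and> lo i < j \<and> j \<le> \<mu> i"
    and lo_le: "1 \<le> i \<Longrightarrow> i \<le> a \<Longrightarrow> lo i \<le> \<mu> i"
    and le_hi: "1 \<le> i \<Longrightarrow> i \<le> a \<Longrightarrow> \<mu> i \<le> hi i"
    and \<mu>_0: "\<mu> 0 = b"
    and \<mu>_Suc_height: "\<mu> (Suc a) = 0"
    and \<mu>_Suc: "i \<le> a \<Longrightarrow> \<mu> (Suc i) \<le> \<mu> i"

lemma (in skew_profile) skew_ideal_row_ends:
  assumes I: "I \<in> order_ideals \<sigma>"
  shows "\<exists>\<mu>. skew_ideal \<sigma> lo hi a b I \<mu>"
proof -
  define m where "m i = Max (insert (lo i) {j. (i, j) \<in> I})" for i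
  define \<mu> where "\<mu> i = (if i = 0 then b else if i \<le> a then m i else 0)" for i
  have sub: "I \<subseteq> \<sigma>" using I by (rule order_ideals_subset)
  have fin: "finite {j. (i, j) \<in> I}" for i
    by (rule finite_subset[of _ "{..hi i}"]) (use sub mem_shape in auto)
  have upper: "j \<le> m i" if "(i, j) \<in> I" for i j
    unfolding m_def using that fin by (intro Max_ge) auto
  have lower: "lo i \<le> m i" for i
    unfolding m_def using fin by (intro Max_ge) auto
  have m_cases: "m i = lo i \<or> (i, m i) \<in> I" for i
    using Max_in[of "insert (lo i) {j. (i, j) \<in> I}"] fin[of i] unfolding m_def[symmetric] by auto
  have mem: "(i, j) \<in> I \<longleftrightarrow> i \<in> {1..a} \<and> lo i < j \<and> j \<le> m i" for i j
  proof
    assume "(i, j) \<in> I"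
    then show "i \<in> {1..a} \<and> lo i < j \<and> j \<le> m i"
      using sub mem_shape upper by blast
  next
    assume ij: "i \<in> {1..a} \<and> lo i < j \<and> j \<le> m i"
    then have top: "(i, m i) \<in> I" using m_cases[of i] by auto
    then have "m i \<le> hi i" using sub mem_shape by blast
    then have "(i, j) \<in> \<sigma>" using ij mem_shape by auto
    then show "(i, j) \<in> I" using order_idealsD[OF I top] ij by simp
  qed
  have m_hi: "m i \<le> hi i" if "1 \<le> i" "i \<le> a" for i
    using m_cases[of i] row_nonempty[OF that] sub mem_shape[of i "m i"] by auto
  \<comment> \<open>Otherwise the last box of row \<open>i + 1\<close> would have a box of the shape, but not of \<open>I\<close>, just above it.\<close>
  have m_Suc: "m (Suc i) \<le> m i" if i: "1 \<le> i" "i < a" for i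
  proof (rule ccontr)
    assume less: "\<not> m (Suc i) \<le> m i"
    then have "lo (Suc i) < m (Suc i)" using lower[of i] lo_antimono[OF i] by linarith
    then have top: "(Suc i, m (Suc i)) \<in> I" using m_cases[of "Suc i"] by auto
    have "m (Suc i) \<le> hi i" using m_hi[of "Suc i"] hi_antimono[OF i] i by auto
    then have "(i, m (Suc i)) \<in> \<sigma>" using mem_shape i less lower[of i] by auto
    then have "(i, m (Suc i)) \<in> I" using order_idealsD[OF I top] by simp
    then show False using upper less by blast
  qed
  have "\<mu> (Suc i) \<le> \<mu> i" if "i \<le> a" for i
    using that m_Suc[of i] m_hi[of 1] hi_first by (cases "i = 0") (auto simp: \<mu>_def)
  then have "skew_ideal \<sigma> lo hi a b I \<mu>"
    using mem lower m_hi by unfold_locales (auto simp: \<mu>_def)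
  then show ?thesis by blast
qed

context skew_ideal
begin

lemma \<mu>_antimono:
  assumes "k \<le> i" "i \<le> Suc a"
  shows "\<mu> i \<le> \<mu> k"
  using assms
proof (induction i rule: dec_induct)
  case (step n)
  then show ?case using \<mu>_Suc[of n] by auto
qed simp

lemma maximal_elements_eq:
  "maximal_elements I = (\<lambda>i. (i, \<mu> i)) ` {i \<in> {1..a}. lo i < \<mu> i \<and> \<mu> (Suc i) < \<mu> i}"
proof (intro set_eqI iffI)
  fix p assume p: "p \<in> maximal_elements I"
  obtain i j where ij: "p = (i, j)" by force
  have mem: "i \<in> {1..a}" "lo i < j" "j \<le> \<mu> i"
    using p mem_ideal[of i j] by (auto simp: ij maximal_elements_def)
  have max: "\<not> (i, j) < (k, l)" if "(k, l) \<in> I" for k l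
    using p that by (auto simp: ij maximal_elements_def)
  have "(i, \<mu> i) \<in> I" using mem mem_ideal by auto
  then have j: "j = \<mu> i" using max[of i "\<mu> i"] mem by (auto simp: less_prod_def)
  moreover have "\<mu> (Suc i) < \<mu> i"
  proof (rule ccontr)
    assume ge: "\<not> \<mu> (Suc i) < \<mu> i"
    then have "i < a" using mem \<mu>_Suc_height by (cases "i = a") auto
    then have "(Suc i, \<mu> i) \<in> I"
      using mem ge j lo_antimono[of i] mem_ideal by auto
    then show False using max[of "Suc i" "\<mu> i"] j by (auto simp: less_prod_def)
  qed
  ultimately show "p \<in> (\<lambda>i. (i, \<mu> i)) ` {i \<in> {1..a}. lo i < \<mu> i \<and> \<mu> (Suc i) < \<mu> i}"
    using mem ij by auto
next
  fix p assume "p \<in> (\<lambda>i. (i, \<mu> i)) ` {i \<in> {1..a}. lo i < \<mu> i \<and> \<mu> (Suc i) < \<mu> i}"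
  then obtain i where i: "p = (i, \<mu> i)" "i \<in> {1..a}" "lo i < \<mu> i" "\<mu> (Suc i) < \<mu> i" by auto
  have "\<not> (i, \<mu> i) < (k, l)" if "(k, l) \<in> I" for k l
  proof
    assume "(i, \<mu> i) < (k, l)"
    then have less: "i \<le> k" "\<mu> i \<le> l" "i < k \<or> \<mu> i < l" by (auto simp: less_prod_def)
    have kl: "k \<le> a" "l \<le> \<mu> k" using that mem_ideal by auto
    show False
    proof (cases "i = k")
      case False
      then have "\<mu> k \<le> \<mu> (Suc i)" using less kl by (intro \<mu>_antimono) auto
      then show False using i less kl by linarith
    qed (use less kl in auto)
  qed
  then show "p \<in> maximal_elements I" using i mem_ideal by (auto simp: maximal_elements_def)
qed

lemma addable_eq:
  "addable \<sigma> I = (\<lambda>i. (i, Suc (\<mu> i))) ` {i \<in> {1..a}. \<mu> i < hi i \<and> \<mu> i < \<mu> (i - 1)}"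
proof (intro set_eqI iffI)
  fix p assume p: "p \<in> addable \<sigma> I"
  obtain i j where ij: "p = (i, j)" by force
  have mem: "i \<in> {1..a}" "lo i < j" "\<mu> i < j" "j \<le> hi i"
    using p mem_ideal[of i j] mem_shape[of i j] by (auto simp: ij addable_def)
  have below: "(k, l) \<in> I" if "(k, l) \<in> \<sigma>" "(k, l) < (i, j)" for k l
    using p that by (auto simp: ij addable_def)
  have j: "j = Suc (\<mu> i)"
  proof (rule ccontr)
    assume "j \<noteq> Suc (\<mu> i)"
    then have "(i, Suc (\<mu> i)) \<in> I"
      using mem lo_le[of i] by (intro below) (auto simp: mem_shape less_prod_def)
    then show False using mem_ideal by auto
  qed
  moreover have "\<mu> i < \<mu> (i - 1)"
  proof (cases "i = 1")
    case True
    then show ?thesis using mem hi_first \<mu>_0 by auto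
  next
    case False
    then obtain k where k: "i = Suc k" "1 \<le> k" "k < a" using mem(1) by (cases i) auto
    have "j \<le> \<mu> k"
    proof (cases "lo k < j")
      case True
      then have "(k, j) \<in> I"
        using mem k hi_antimono[of k] by (intro below) (auto simp: mem_shape less_prod_def)
      then show ?thesis using mem_ideal by auto
    qed (use lo_le[of k] k in auto)
    then show ?thesis using j k by auto
  qed
  ultimately show "p \<in> (\<lambda>i. (i, Suc (\<mu> i))) ` {i \<in> {1..a}. \<mu> i < hi i \<and> \<mu> i < \<mu> (i - 1)}"
    using mem ij by auto
next
  fix p assume "p \<in> (\<lambda>i. (i, Suc (\<mu> i))) ` {i \<in> {1..a}. \<mu> i < hi i \<and> \<mu> i < \<mu> (i - 1)}"
  then obtain i where i: "p = (i, Suc (\<mu> i))" "i \<in> {1..a}" "\<mu> i < hi i" "\<mu> i < \<mu> (i - 1)" by auto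
  have "(k, l) \<in> I" if "(k, l) \<in> \<sigma>" "(k, l) < (i, Suc (\<mu> i))" for k l
  proof -
    have less: "k \<le> i" "l \<le> Suc (\<mu> i)" "k < i \<or> l \<le> \<mu> i" using that(2) by (auto simp: less_prod_def)
    have kl: "k \<in> {1..a}" "lo k < l" using that(1) mem_shape by auto
    have "l \<le> \<mu> k"
    proof (cases "k = i")
      case False
      then have "\<mu> (i - 1) \<le> \<mu> k" using less i by (intro \<mu>_antimono) auto
      then show ?thesis using less i by linarith
    qed (use less in auto)
    then show ?thesis using kl mem_ideal by auto
  qed
  then show "p \<in> addable \<sigma> I"
    using i mem_ideal mem_shape lo_le[of i] by (auto simp: addable_def)
qed

end

section \<open>The weighted count of the turns of the boundary path\<close>

text \<open>On the antidiagonal of the bounding rectangle this function is zero. It is the displacement of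
  a southeast corner at \<open>(i, j)\<close> and the negative of that of a northwest corner.\<close>

definition tilt :: "nat \<Rightarrow> nat \<Rightarrow> nat \<Rightarrow> nat \<Rightarrow> real" where
  "tilt a b i j = real i / real a + real j / real b - 1"

text \<open>Both sums are extended to all turns of the boundary path, the added terms being zero: turns
  that belong to no toggleable box are outward corners, and the turns missing at the two ends of
  the path would be at \<open>(0, b)\<close> and \<open>(a, 0)\<close>. The two turns on a common horizontal line then
  differ by the length of the run between them divided by \<open>b\<close>, and the lengths add up to \<open>b\<close>.\<close>

lemma (in skew_ideal) tilt_turns:
  assumes northwest: "\<And>i. 1 \<le> i \<Longrightarrow> i < a \<Longrightarrow> lo (Suc i) < lo i \<Longrightarrow> tilt a b i (lo i) = 0"
    and southeast: "\<And>i. 1 \<le> i \<Longrightarrow> i < a \<Longrightarrow> hi (Suc i) < hi i \<Longrightarrow> tilt a b i (hi (Suc i)) = 0"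
  shows "(\<Sum>(i, j)\<in>maximal_elements I. tilt a b i j)
    - (\<Sum>(i, j)\<in>addable \<sigma> I. tilt a b (i - 1) (j - 1)) = 1"
proof -
  \<comment> \<open>\<open>f i\<close> and \<open>g i\<close> are the contributions of the two ends of the run on the horizontal line \<open>i\<close>.\<close>
  define f where "f i = (if \<mu> (Suc i) < \<mu> i then tilt a b i (\<mu> i) else 0)" for i
  define g where "g i = (if \<mu> (Suc i) < \<mu> i then tilt a b i (\<mu> (Suc i)) else 0)" for i
  have corner_nw: "tilt a b i (\<mu> i) = 0"
    if i: "1 \<le> i" "i \<le> a" and eq: "\<mu> i = lo i" and less: "\<mu> (Suc i) < \<mu> i" for i
  proof -
    have "i \<noteq> a" using eq less lo_last by auto
    then show ?thesis using northwest[of i] lo_le[of "Suc i"] i eq less by auto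
  qed
  have corner_se: "tilt a b i (\<mu> (Suc i)) = 0"
    if i: "i < a" and eq: "\<mu> (Suc i) = hi (Suc i)" and less: "\<mu> (Suc i) < \<mu> i" for i
  proof -
    have "i \<noteq> 0" using eq less hi_first \<mu>_0 by (cases i) auto
    then show ?thesis using southeast[of i] le_hi[of i] i eq less by auto
  qed
  have "(\<Sum>(i, j)\<in>maximal_elements I. tilt a b i j)
      = (\<Sum>i | i \<in> {1..a} \<and> lo i < \<mu> i \<and> \<mu> (Suc i) < \<mu> i. tilt a b i (\<mu> i))"
    unfolding maximal_elements_eq by (subst sum.reindex) (auto simp: inj_on_def)
  also have "\<dots> = (\<Sum>i\<in>{1..a}. f i)"
  proof (rule sum.mono_neutral_cong_left)
    show "\<forall>i\<in>{1..a} - {i \<in> {1..a}. lo i < \<mu> i \<and> \<mu> (Suc i) < \<mu> i}. f i = 0"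
    proof
      fix i assume i: "i \<in> {1..a} - {i \<in> {1..a}. lo i < \<mu> i \<and> \<mu> (Suc i) < \<mu> i}"
      then show "f i = 0" using lo_le[of i] corner_nw[of i] by (auto simp: f_def)
    qed
  qed (auto simp: f_def)
  also have "\<dots> = (\<Sum>i<Suc a. f i)"
  proof (rule sum.mono_neutral_cong_left)
    show "\<forall>i\<in>{..<Suc a} - {1..a}. f i = 0"
      using width_pos \<mu>_0 by (auto simp: f_def tilt_def not_le)
  qed auto
  finally have F: "(\<Sum>(i, j)\<in>maximal_elements I. tilt a b i j) = (\<Sum>i<Suc a. f i)" .

  have "(\<Sum>(i, j)\<in>addable \<sigma> I. tilt a b (i - 1) (j - 1))
      = (\<Sum>i | i \<in> {1..a} \<and> \<mu> i < hi i \<and> \<mu> i < \<mu> (i - 1). tilt a b (i - 1) (\<mu> i))"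
    unfolding addable_eq by (subst sum.reindex) (auto simp: inj_on_def)
  also have "\<dots> = (\<Sum>i\<in>{1..a}. g (i - 1))"
  proof (rule sum.mono_neutral_cong_left)
    show "\<forall>i\<in>{1..a} - {i \<in> {1..a}. \<mu> i < hi i \<and> \<mu> i < \<mu> (i - 1)}. g (i - 1) = 0"
    proof
      fix i assume i: "i \<in> {1..a} - {i \<in> {1..a}. \<mu> i < hi i \<and> \<mu> i < \<mu> (i - 1)}"
      then show "g (i - 1) = 0"
        using le_hi[of i] corner_se[of "i - 1"] by (auto simp: g_def)
    qed
  qed (auto simp: g_def)
  also have "\<dots> = (\<Sum>i<a. g i)"
    using sum.atLeast1_atMost_eq[of "\<lambda>i. g (i - 1)" a] by simp
  also have "\<dots> = (\<Sum>i<Suc a. g i)"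
    using height_pos \<mu>_Suc_height by (simp add: g_def tilt_def)
  finally have G: "(\<Sum>(i, j)\<in>addable \<sigma> I. tilt a b (i - 1) (j - 1)) = (\<Sum>i<Suc a. g i)" .

  have "f i - g i = (real (\<mu> i) - real (\<mu> (Suc i))) / real b" if "i < Suc a" for i
    using \<mu>_Suc[of i] that
    by (cases "\<mu> (Suc i) = \<mu> i") (auto simp: f_def g_def tilt_def diff_divide_distrib)
  then have "(\<Sum>i<Suc a. f i) - (\<Sum>i<Suc a. g i)
      = (\<Sum>i<Suc a. real (\<mu> i) - real (\<mu> (Suc i))) / real b"
    unfolding sum_subtractf[symmetric] sum_divide_distrib by (intro sum.cong) auto
  also have "\<dots> = 1"
    using width_pos \<mu>_0 \<mu>_Suc_height unfolding sum_lessThan_telescope'[of "\<lambda>i. real (\<mu> i)"] by simp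
  finally show ?thesis using F G by simp
qed

text \<open>The point \<open>(i - 1, j - 1)\<close> where the box \<open>[i, j]\<close> can be added has tilt smaller by
  \<open>1/a + 1/b = 1/c\<close> than the point \<open>(i, j)\<close> where it can be removed. This excess turns
  the weighted count of turns into an unweighted count of addable boxes.\<close>

lemma (in skew_profile) card_maximal_eq:
  assumes northwest: "\<And>i. 1 \<le> i \<Longrightarrow> i < a \<Longrightarrow> lo (Suc i) < lo i \<Longrightarrow> tilt a b i (lo i) = 0"
    and southeast: "\<And>i. 1 \<le> i \<Longrightarrow> i < a \<Longrightarrow> hi (Suc i) < hi i \<Longrightarrow> tilt a b i (hi (Suc i)) = 0"
    and I: "I \<in> order_ideals \<sigma>"
  defines "c \<equiv> real (a * b) / real (a + b)"
  shows "real (card (maximal_elements I)) = c +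
    (\<Sum>p\<in>\<sigma>. (c * tilt a b (fst p) (snd p) - 1) * toggleability \<sigma> I p)"
proof -
  obtain \<mu> where "skew_ideal \<sigma> lo hi a b I \<mu>" using skew_ideal_row_ends[OF I] ..
  then interpret skew_ideal \<sigma> lo hi a b I \<mu> .
  let ?M = "maximal_elements I" and ?A = "addable \<sigma> I"
  let ?t = "\<lambda>p. tilt a b (fst p) (snd p)"
  define d where "d = 1 / real a + 1 / real b"
  have MA: "?M \<subseteq> \<sigma>" "?A \<subseteq> \<sigma>"
    using order_ideals_subset[OF I] by (auto simp: maximal_elements_def addable_def)
  have inside: "(\<Sum>p\<in>\<sigma>. h p * toggleability \<sigma> I p) = sum h ?A - sum h ?M" for h
  proof -
    have "(\<Sum>p\<in>\<sigma>. h p * of_bool (p \<in> S)) = sum h S" if "S \<subseteq> \<sigma>" for S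
      using finite_shape that by (intro sum.mono_neutral_cong_right) auto
    then show ?thesis
      using MA by (simp add: toggleability_def right_diff_distrib sum_subtractf)
  qed
  have pos: "0 < real a" "0 < real b" using height_pos width_pos by auto
  have shift: "(case p of (i, j) \<Rightarrow> tilt a b (i - 1) (j - 1)) = ?t p - d" if "p \<in> ?A" for p
  proof -
    obtain i j where p: "p = (i, j)" by force
    have "1 \<le> i" "1 \<le> j" using that MA mem_shape[of i j] by (auto simp: p)
    then show ?thesis by (simp add: p tilt_def d_def of_nat_diff diff_divide_distrib)
  qed
  have "1 = sum ?t ?M - (\<Sum>p\<in>?A. ?t p - d)"
    using tilt_turns[OF northwest southeast] shift
    by (simp add: case_prod_unfold cong: sum.cong)
  also have "\<dots> = sum ?t ?M - sum ?t ?A + real (card ?A) * d"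
    by (simp add: sum_subtractf)
  finally have "c * 1 = c * (sum ?t ?M - sum ?t ?A + real (card ?A) * d)" by simp
  moreover have "c * d = 1" using pos by (simp add: c_def d_def add_divide_distrib[symmetric] add_frac_eq add.commute)
  then have "c * (real (card ?A) * d) = real (card ?A)" by (simp add: mult.left_commute)
  ultimately have "real (card ?A) = c + c * sum ?t ?A - c * sum ?t ?M"
    by (simp add: algebra_simps)
  then show ?thesis
    unfolding inside by (simp add: sum_subtractf sum_distrib_left[symmetric])
qed

section \<open>The normal form of a connected skew shape\<close>

lemma connected_poset_crossing:
  assumes "connected_poset P" and u: "u \<in> P" "Q u" and v: "v \<in> P" "\<not> Q v"
  obtains x y where "x \<in> P" "y \<in> P" "Q x" "\<not> Q y" "x \<le> y \<or> y \<le> x"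
proof -
  have "(u, v) \<in> {(u, v). u \<in> P \<and> v \<in> P \<and> (u \<le> v \<or> v \<le> u)}\<^sup>*"
    using assms unfolding connected_poset_def by blast
  then have "Q v \<or> (\<exists>x\<in>P. \<exists>y\<in>P. Q x \<and> \<not> Q y \<and> (x \<le> y \<or> y \<le> x))"
    by (induction rule: rtrancl_induct) (use \<open>Q u\<close> in blast)+
  then show ?thesis using that v by blast
qed

lemma contiguous_nat_set:
  fixes A :: "nat set"
  assumes "finite A" "1 \<in> A" "0 \<notin> A"
    and gap: "\<And>k x y. x \<in> A \<Longrightarrow> y \<in> A \<Longrightarrow> x \<le> k \<Longrightarrow> k < y \<Longrightarrow> k \<in> A"
  shows "A = {1..card A}"
proof -
  have Max: "Max A \<in> A" using assms(1,2) by (intro Max_in) auto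
  have "A = {1..Max A}"
  proof (intro set_eqI iffI)
    fix k assume "k \<in> A"
    then show "k \<in> {1..Max A}" using assms(1,3) by (cases k) auto
  next
    fix k assume "k \<in> {1..Max A}"
    then show "k \<in> A" using gap[OF \<open>1 \<in> A\<close> Max, of k] Max by (cases "k = Max A") auto
  qed
  then show ?thesis by (metis card_atLeastAtMost diff_Suc_1)
qed

lemma is_partition_antimono:
  assumes "is_partition p" "1 \<le> i" "i \<le> k"
  shows "p k \<le> p i"
  using assms(3)
proof (induction k rule: dec_induct)
  case (step n)
  then show ?case using assms(1,2) unfolding is_partition_def
    by (metis Suc_eq_plus1 le_trans)
qed simp

lemma finite_skew_diagram:
  assumes "is_partition lam"
  shows "finite (skew_diagram lam nu)"
proof (rule finite_subset)
  show "skew_diagram lam nu \<subseteq> (SIGMA i:{i. lam i \<noteq> 0}. {..lam i})"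
    by (auto simp: skew_diagram_def)
qed (use assms in \<open>auto simp: is_partition_def\<close>)

text \<open>Translating the diagram by \<open>(r - 1, c - 1)\<close> again gives row intervals. Truncated subtraction
  is harmless: a bound left of column \<open>c\<close> becomes \<open>0\<close>, and no box of the diagram lies there.\<close>

lemma skew_shape_rows:
  assumes lam: "is_partition lam" and nu: "is_partition nu"
    and nonempty: "skew_shape lam nu \<noteq> {}"
  obtains lo hi where
    "\<And>i j. (i, j) \<in> skew_shape lam nu \<longleftrightarrow> 1 \<le> i \<and> lo i < j \<and> j \<le> hi i"
    "\<And>i k. 1 \<le> i \<Longrightarrow> i \<le> k \<Longrightarrow> lo k \<le> lo i"
    "\<And>i k. 1 \<le> i \<Longrightarrow> i \<le> k \<Longrightarrow> hi k \<le> hi i"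
    "1 \<in> fst ` skew_shape lam nu" "1 \<in> snd ` skew_shape lam nu"
proof -
  let ?\<sigma> = "skew_shape lam nu"
  define D where "D = skew_diagram lam nu"
  define r where "r = Min (fst ` D)"
  define c where "c = Min (snd ` D)"
  have \<sigma>: "?\<sigma> = (\<lambda>(i, j). (i + 1 - r, j + 1 - c)) ` D"
    by (simp add: skew_shape_def D_def r_def c_def Let_def)
  have fin: "finite D" unfolding D_def using lam by (rule finite_skew_diagram)
  have ne: "D \<noteq> {}" using nonempty \<sigma> by auto
  have mem_D: "(i, j) \<in> D \<longleftrightarrow> 1 \<le> i \<and> nu i < j \<and> j \<le> lam i" for i j
    by (simp add: D_def skew_diagram_def)
  have min: "r \<le> i \<and> c \<le> j" if "(i, j) \<in> D" for i j
  proof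
    show "r \<le> i" unfolding r_def using that fin by (intro Min_le) force+
    show "c \<le> j" unfolding c_def using that fin by (intro Min_le) force+
  qed
  have r: "r \<in> fst ` D" and c: "c \<in> snd ` D"
    unfolding r_def c_def using fin ne by (auto intro!: Min_in simp del: Min_in)
  have pos: "1 \<le> r" "1 \<le> c" using r c mem_D by auto
  define lo where "lo i = nu (i + (r - 1)) - (c - 1)" for i
  define hi where "hi i = lam (i + (r - 1)) - (c - 1)" for i
  show ?thesis
  proof (rule that)
    show "(i, j) \<in> ?\<sigma> \<longleftrightarrow> 1 \<le> i \<and> lo i < j \<and> j \<le> hi i" for i j
    proof
      assume "(i, j) \<in> ?\<sigma>"
      then obtain k l where kl: "(k, l) \<in> D" "i = k + 1 - r" "j = l + 1 - c"
        unfolding \<sigma> by auto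
      have "i + (r - 1) = k" "j + (c - 1) = l" "1 \<le> i" "1 \<le> j" using kl min[OF kl(1)] pos by auto
      then show "1 \<le> i \<and> lo i < j \<and> j \<le> hi i"
        using kl(1) by (auto simp: lo_def hi_def mem_D)
    next
      assume ij: "1 \<le> i \<and> lo i < j \<and> j \<le> hi i"
      then have "(i + (r - 1), j + (c - 1)) \<in> D" by (auto simp: lo_def hi_def mem_D)
      moreover have "(i, j) = (i + (r - 1) + 1 - r, j + (c - 1) + 1 - c)" using pos by auto
      ultimately show "(i, j) \<in> ?\<sigma>" unfolding \<sigma> by (force simp: image_iff)
    qed
    show "lo k \<le> lo i" if "1 \<le> i" "i \<le> k" for i k
      unfolding lo_def using is_partition_antimono[OF nu] that by (intro diff_le_mono) auto
    show "hi k \<le> hi i" if "1 \<le> i" "i \<le> k" for i k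
      unfolding hi_def using is_partition_antimono[OF lam] that by (intro diff_le_mono) auto
    show "1 \<in> fst ` ?\<sigma>" using r unfolding \<sigma> by (force simp: image_iff)
    show "1 \<in> snd ` ?\<sigma>" using c unfolding \<sigma> by (force simp: image_iff)
  qed
qed

text \<open>A comparability chain between boxes on both sides of a horizontal or vertical line contains a
  comparable pair on both sides of it. The interval between the pair lies in the shape and
  crosses the line. Hence rows and columns are contiguous, and consecutive rows share a column.\<close>

lemma connected_skew_shape_profile:
  assumes lam: "is_partition lam" and nu: "is_partition nu"
    and \<sigma>: "\<sigma> = skew_shape lam nu" and conn: "connected_poset \<sigma>"
  obtains lo hi where "skew_profile \<sigma> lo hi (shape_height \<sigma>) (shape_width \<sigma>)"
proof -
  have "\<sigma> \<noteq> {}" using conn by (simp add: connected_poset_def)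
  then obtain lo hi where
    mem: "\<And>i j. (i, j) \<in> \<sigma> \<longleftrightarrow> 1 \<le> i \<and> lo i < j \<and> j \<le> hi i"
    and lo: "\<And>i k. 1 \<le> i \<Longrightarrow> i \<le> k \<Longrightarrow> lo k \<le> lo i"
    and hi: "\<And>i k. 1 \<le> i \<Longrightarrow> i \<le> k \<Longrightarrow> hi k \<le> hi i"
    and one: "1 \<in> fst ` \<sigma>" "1 \<in> snd ` \<sigma>"
    using skew_shape_rows[OF lam nu] unfolding \<sigma> by metis
  have fin: "finite \<sigma>"
    unfolding \<sigma> skew_shape_def Let_def using finite_skew_diagram[OF lam] by simp
  let ?a = "shape_height \<sigma>" and ?b = "shape_width \<sigma>"
  have row_cut: "\<exists>j. (i, j) \<in> \<sigma> \<and> (Suc i, j) \<in> \<sigma>"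
    if "u \<in> \<sigma>" "fst u \<le> i" "v \<in> \<sigma>" "i < fst v" for i u v
  proof -
    obtain x y where xy: "x \<in> \<sigma>" "y \<in> \<sigma>" "fst x \<le> i" "\<not> fst y \<le> i" "x \<le> y \<or> y \<le> x"
      using connected_poset_crossing[OF conn, of u "\<lambda>p. fst p \<le> i" v] \<open>u \<in> \<sigma>\<close> \<open>fst u \<le> i\<close>
        \<open>v \<in> \<sigma>\<close> \<open>i < fst v\<close> by (metis not_le)
    obtain k l k' l' where kl: "x = (k, l)" "y = (k', l')" by force
    have le: "k \<le> i" "i < k'" "l \<le> l'" using xy by (auto simp: kl)
    have "1 \<le> k" "lo k < l" "l' \<le> hi k'" using xy mem by (auto simp: kl)
    then have "(i, l) \<in> \<sigma> \<and> (Suc i, l) \<in> \<sigma>"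
      using le lo[of k i] lo[of k "Suc i"] hi[of i k'] hi[of "Suc i" k'] by (auto simp: mem)
    then show ?thesis ..
  qed
  have column_cut: "j \<in> snd ` \<sigma>" if "u \<in> \<sigma>" "snd u \<le> j" "v \<in> \<sigma>" "j < snd v" for j u v
  proof -
    obtain x y where xy: "x \<in> \<sigma>" "y \<in> \<sigma>" "snd x \<le> j" "\<not> snd y \<le> j" "x \<le> y \<or> y \<le> x"
      using connected_poset_crossing[OF conn, of u "\<lambda>p. snd p \<le> j" v] \<open>u \<in> \<sigma>\<close> \<open>snd u \<le> j\<close>
        \<open>v \<in> \<sigma>\<close> \<open>j < snd v\<close> by (metis not_le)
    obtain k l k' l' where kl: "x = (k, l)" "y = (k', l')" by force
    have le: "k \<le> k'" "l \<le> j" "j < l'" using xy by (auto simp: kl)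
    have "1 \<le> k" "lo k < l" "l' \<le> hi k'" using xy mem by (auto simp: kl)
    then have "(k, j) \<in> \<sigma>" using le hi[of k k'] by (auto simp: mem)
    then show ?thesis by force
  qed
  have rows: "fst ` \<sigma> = {1..?a}"
    unfolding shape_height_def
  proof (rule contiguous_nat_set)
    fix k x y assume "x \<in> fst ` \<sigma>" "y \<in> fst ` \<sigma>" "x \<le> k" "k < y"
    then show "k \<in> fst ` \<sigma>" using row_cut by (force simp: image_iff)
  qed (use fin one mem in auto)
  have columns: "snd ` \<sigma> = {1..?b}"
    unfolding shape_width_def
  proof (rule contiguous_nat_set)
    fix k x y assume "x \<in> snd ` \<sigma>" "y \<in> snd ` \<sigma>" "x \<le> k" "k < y"
    then show "k \<in> snd ` \<sigma>" using column_cut by blast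
  qed (use fin one mem in auto)
  have row_bound: "i \<le> ?a" if "(i, j) \<in> \<sigma>" for i j
    using that rows by force
  have row_ex: "\<exists>j. (i, j) \<in> \<sigma>" if "1 \<le> i" "i \<le> ?a" for i
  proof -
    have "i \<in> fst ` \<sigma>" using that rows by auto
    then show ?thesis by force
  qed
  have height: "1 \<le> ?a" using one(1) rows by auto
  have "skew_profile \<sigma> lo hi ?a ?b"
  proof
    show "(i, j) \<in> \<sigma> \<longleftrightarrow> i \<in> {1..?a} \<and> lo i < j \<and> j \<le> hi i" for i j
      using mem row_bound by auto
    show "1 \<le> ?a" by (rule height)
    show "lo (Suc i) \<le> lo i" "hi (Suc i) \<le> hi i" if "1 \<le> i" "i < ?a" for i
      using lo hi that by auto
    show "lo i < hi i" if "1 \<le> i" "i \<le> ?a" for i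
      using row_ex[OF that] mem by auto
    show "lo i < hi (Suc i)" if i: "1 \<le> i" "i < ?a" for i
    proof -
      obtain j j' where "(i, j) \<in> \<sigma>" "(Suc i, j') \<in> \<sigma>"
        using row_ex[of i] row_ex[of "Suc i"] i by auto
      then obtain l where "(i, l) \<in> \<sigma>" "(Suc i, l) \<in> \<sigma>"
        using row_cut[of "(i, j)" i "(Suc i, j')"] by auto
      then show ?thesis using mem by force
    qed
    show "lo ?a = 0"
    proof -
      obtain i where i: "(i, 1) \<in> \<sigma>" using one(2) by force
      then have "1 \<le> i" "i \<le> ?a" "lo i = 0" using row_bound mem by auto
      then show ?thesis using lo[of i ?a] by simp
    qed
    show "hi 1 = ?b"
    proof (rule antisym)
      obtain j where "(1, j) \<in> \<sigma>" using row_ex[of 1] height by auto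
      then have "(1, hi 1) \<in> \<sigma>" by (auto simp: mem)
      then show "hi 1 \<le> ?b" using columns by force
      have "?b \<in> snd ` \<sigma>" using columns one(2) by auto
      then obtain i where "(i, ?b) \<in> \<sigma>" by force
      then show "?b \<le> hi 1" using hi[of 1 i] by (auto simp: mem)
    qed
  qed
  then show ?thesis by (rule that)
qed

theorem corollary3p11:
  fixes lam nu :: "nat \<Rightarrow> nat"
    and \<sigma> :: "box set"
    and a b :: nat
    and \<phi> :: "box set \<Rightarrow> box set"
  assumes "is_partition lam" and "is_partition nu"
    and "\<forall>i\<ge>1. nu i \<le> lam i"
    and "\<sigma> = skew_shape lam nu"
    and "balanced \<sigma>"
    and "a = shape_height \<sigma>" and "b = shape_width \<sigma>"
    and "is_rowmotion \<sigma> \<phi> \<or> is_gyration \<sigma> \<phi>"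
  shows "mesic (order_ideals \<sigma>) \<phi> (\<lambda>I. real (card (maximal_elements I)))
           (real (a * b) / real (a + b))"
proof -
  have conn: "connected_poset \<sigma>"
    and corner: "\<And>c. c \<in> outward_corners \<sigma> \<Longrightarrow> displacement \<sigma> c = 0"
    using \<open>balanced \<sigma>\<close> by (auto simp: balanced_def)
  obtain lo hi where "skew_profile \<sigma> lo hi a b"
    using connected_skew_shape_profile[OF assms(1,2,4) conn] assms(6,7) by blast
  then interpret skew_profile \<sigma> lo hi a b .
  have northwest: "tilt a b i (lo i) = 0"
    if i: "1 \<le> i" "i < a" and step: "lo (Suc i) < lo i" for i
  proof -
    have "Northwest i (lo i) \<in> outward_corners \<sigma>"
      using i step rows_overlap[OF i] row_nonempty[of i]
      by (auto simp: outward_corners_def mem_shape)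
    then show ?thesis using corner assms(6,7) by (fastforce simp: tilt_def)
  qed
  have southeast: "tilt a b i (hi (Suc i)) = 0"
    if i: "1 \<le> i" "i < a" and step: "hi (Suc i) < hi i" for i
  proof -
    have "Southeast i (hi (Suc i)) \<in> outward_corners \<sigma>"
      using i step rows_overlap[OF i] row_nonempty[of "Suc i"]
      by (auto simp: outward_corners_def mem_shape)
    then show ?thesis using corner assms(6,7) by (fastforce simp: tilt_def)
  qed
  show ?thesis
    using finite_shape assms(8) card_maximal_eq[OF northwest southeast]
    by (rule mesic_if_toggle_combination)
qed

end
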